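(* Let $\mathcal{S}=\{(\alpha,\beta,\gamma)\in\mathbb{C}^3:\alpha+\beta+\gamma+\alpha\beta\gamma=0\}$, and let the symmetric group $\mathfrak{S}_3$ act on $\mathcal{S}$ by the standard permutation action on coordinates multiplied by the sign representation. Then the map $$\mathcal{S}/\mathfrak{S}_3\twoheadrightarrow\{\text{isomorphism classes of four-dimensional Sklyanin algebras}\}$$ sending the orbit of $(\alpha,\beta,\gamma)$ to the class of the algebra $A=A(\alpha,\beta,\gamma)$ is a bijection.
   Context: For $(\alpha,\beta,\gamma)\in\mathcal{S}$, the four-dimensional Sklyanin algebra is $A(\alpha,\beta,\gamma)=\mathbb{C}\langle x_0,x_1,x_2,x_3\rangle/I$, where $I$ is the two-sided ideal generated by $r_1=x_0x_1-x_1x_0-\alpha(x_2x_3+x_3x_2)$, $s_1=x_0x_1+x_1x_0-(x_2x_3-x_3x_2)$, $r_2=x_0x_2-x_2x_0-\beta(x_3x_1+x_1x_3)$, $s_2=x_0x_2+x_2x_0-(x_3x_1-x_1x_3)$, $r_3=x_0x_3-x_3x_0-\gamma(x_1x_2+x_2x_1)$, $s_3=x_0x_3+x_3x_0-(x_1x_2-x_2x_1)$, graded with all $x_i$ in degree $1$. All $(\alpha,\beta,\gamma)\in\mathcal{S}$ are allowed. "Isomorphism" means graded $\mathbb{C}$-algebra isomorphism. For example, under the $\mathfrak{S}_3$ action a cyclic permutation sends $(\alpha,\beta,\gamma)$ to $(\gamma,\alpha,\beta)$ and a transposition sends it to $(-\beta,-\alpha,-\gamma)$; parameters in the same orbit give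 isomorphic algebras. *)

theory Defs
  imports
    "HOL-Analysis.Analysis"
    "HOL-Algebra.Algebra"
    "HOL-Algebra.Algebraic_Closure_Type"
    "HOL-Library.Poly_Mapping"
begin

no_notation fps_nth (infixl \<open>$\<close> 75)

section \<open>The free algebra\<close>

text \<open>
  Words under concatenation, written additively: the convolution product on
  \<^typ>\<open>'m \<Rightarrow>\<^sub>0 'b\<close> takes an additive, not necessarily commutative, monoid \<^typ>\<open>'m\<close>.
\<close>

datatype 'x word = Word (letters: "'x list")

instantiation word :: (type) monoid_add
begin
definition zero_word :: "'a word" where "0 = Word []"
definition plus_word :: "'a word \<Rightarrow> 'a word \<Rightarrow> 'a word"
  where "u + v = Word (letters u @ letters v)"
instance by intro_classes (auto simp: zero_word_def plus_word_def)
end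

type_synonym 'x free_algebra = "'x word \<Rightarrow>\<^sub>0 complex"

definition gen :: "'x \<Rightarrow> 'x free_algebra"
  where "gen i = Poly_Mapping.single (Word [i]) 1"

definition scalar :: "complex \<Rightarrow> 'x free_algebra"
  where "scalar c = Poly_Mapping.single 0 c"

definition homogeneous :: "nat \<Rightarrow> 'x free_algebra set"
  where "homogeneous n = {f. \<forall>w \<in> Poly_Mapping.keys f. length (letters w) = n}"

abbreviation free_ring :: "'x free_algebra ring"
  where "free_ring \<equiv> ring_of_type_algebra"


section \<open>Graded algebras and their isomorphisms\<close>

text \<open>The record \<^typ>\<open>('a, 'b) module\<close> provides ring operations together with a scalar action.\<close>

record 'b graded_algebra = "(complex, 'b) module" +
  part :: "nat \<Rightarrow> 'b set"

definition graded_iso :: "'b graded_algebra \<Rightarrow> 'c graded_algebra \<Rightarrow> ('b \<Rightarrow> 'c) set"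
  where "graded_iso A B =
    {h \<in> ring_iso A B.
       (\<forall>c. \<forall>x \<in> carrier A. h (c \<odot>\<^bsub>A\<^esub> x) = c \<odot>\<^bsub>B\<^esub> h x) \<and>
       (\<forall>n. h ` part A n = part B n)}"

definition graded_isomorphic :: "'b graded_algebra \<Rightarrow> 'c graded_algebra \<Rightarrow> bool"
  where "graded_isomorphic A B \<longleftrightarrow> graded_iso A B \<noteq> {}"

text \<open>
  The quotient of the free algebra by the two-sided ideal generated by \<open>R\<close>; it is
  graded when the elements of \<open>R\<close> are homogeneous.
  As in \<^const>\<open>rcoset_mult\<close>, the scalar action is defined through all representatives.
\<close>

definition presented_algebra :: "'x free_algebra set \<Rightarrow> 'x free_algebra set graded_algebra"
  where "presented_algebra R =
    (let I = Idl\<^bsub>free_ring\<^esub> R; Q = free_ring Quot I in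
     \<lparr>carrier = carrier Q, monoid.mult = monoid.mult Q, one = monoid.one Q,
      ring.zero = ring.zero Q, add = ring.add Q,
      smult = (\<lambda>c C. \<Union>f\<in>C. I +>\<^bsub>free_ring\<^esub> (scalar c * f)),
      part = (\<lambda>n. (\<lambda>f. I +>\<^bsub>free_ring\<^esub> f) ` homogeneous n)\<rparr>)"


section \<open>Sklyanin algebras\<close>

text \<open>The parameters \<open>(\<alpha>, \<beta>, \<gamma>)\<close> are \<open>(v $ 1, v $ 2, v $ 3)\<close>.\<close>

definition sklyanin_params :: "(complex ^ 3) set"
  where "sklyanin_params = {v. v $ 1 + v $ 2 + v $ 3 + v $ 1 * v $ 2 * v $ 3 = 0}"

definition sklyanin_relations :: "complex ^ 3 \<Rightarrow> 4 free_algebra set"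
  where "sklyanin_relations v =
    (let x0 = gen 0; x1 = gen 1; x2 = gen 2; x3 = gen 3;
         \<alpha> = scalar (v $ 1); \<beta> = scalar (v $ 2); \<gamma> = scalar (v $ 3)
     in {x0 * x1 - x1 * x0 - \<alpha> * (x2 * x3 + x3 * x2), x0 * x1 + x1 * x0 - (x2 * x3 - x3 * x2),
         x0 * x2 - x2 * x0 - \<beta> * (x3 * x1 + x1 * x3), x0 * x2 + x2 * x0 - (x3 * x1 - x1 * x3),
         x0 * x3 - x3 * x0 - \<gamma> * (x1 * x2 + x2 * x1), x0 * x3 + x3 * x0 - (x1 * x2 - x2 * x1)})"

definition sklyanin :: "complex ^ 3 \<Rightarrow> 4 free_algebra set graded_algebra"
  where "sklyanin v = presented_algebra (sklyanin_relations v)"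

definition sklyanin_iso_rel :: "4 free_algebra set graded_algebra rel"
  where "sklyanin_iso_rel =
    {(A, B). A \<in> sklyanin ` sklyanin_params \<and> B \<in> sklyanin ` sklyanin_params \<and>
             graded_isomorphic A B}"

definition sklyanin_iso_classes :: "4 free_algebra set graded_algebra set set"
  where "sklyanin_iso_classes = (sklyanin ` sklyanin_params) // sklyanin_iso_rel"

definition sklyanin_iso_class :: "complex ^ 3 \<Rightarrow> 4 free_algebra set graded_algebra set"
  where "sklyanin_iso_class v = sklyanin_iso_rel `` {sklyanin v}"


section \<open>The action of the symmetric group\<close>

abbreviation S3 :: "(3 \<Rightarrow> 3) monoid"
  where "S3 \<equiv> BijGroup UNIV"

definition signed_perm :: "(3 \<Rightarrow> 3) \<Rightarrow> complex ^ 3 \<Rightarrow> complex ^ 3"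
  where "signed_perm \<sigma> =
    (\<lambda>v \<in> sklyanin_params. \<chi> i. of_int (sign \<sigma>) * v $ (inv_into UNIV \<sigma> i))"

definition param_orbit :: "complex ^ 3 \<Rightarrow> (complex ^ 3) set"
  where "param_orbit v = Group_Action.orbit S3 signed_perm v"

definition param_orbits :: "(complex ^ 3) set set"
  where "param_orbits = Group_Action.orbits S3 sklyanin_params signed_perm"

text \<open>
  The map induced on orbits by \<^const>\<open>sklyanin_iso_class\<close>. The use of \<^const>\<open>the_elem\<close>
  is meaningful only if that function is constant on the orbit.
\<close>

definition orbit_to_class :: "(complex ^ 3) set \<Rightarrow> 4 free_algebra set graded_algebra set"
  where "orbit_to_class P = the_elem (sklyanin_iso_class ` P)"


section \<open>Basic consistency facts\<close>

lemma ring_free_ring: "ring (free_ring :: 'x free_algebra ring)"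
proof -
  have "\<exists>y. x + y = 0" for x :: "'x free_algebra"
    using add.right_inverse by blast
  thus ?thesis
    unfolding ring_of_type_algebra_def
    by unfold_locales (auto simp: algebra_simps Units_def)
qed

lemma ideal_Idl: "ideal (Idl\<^bsub>free_ring\<^esub> R) (free_ring :: 'x free_algebra ring)"
  by (rule ring.genideal_ideal[OF ring_free_ring]) (simp add: ring_of_type_algebra_def)

lemma ring_presented_algebra:
  "ring (free_ring Quot (Idl\<^bsub>free_ring\<^esub> R))" for R :: "'x free_algebra set"
  by (rule ideal.quotient_is_ring[OF ideal_Idl])

lemma smult_presented_algebra:
  fixes R :: "'x free_algebra set"
  defines "I \<equiv> Idl\<^bsub>free_ring\<^esub> R"
  shows "c \<odot>\<^bsub>presented_algebra R\<^esub> (I +>\<^bsub>free_ring\<^esub> f) = I +>\<^bsub>free_ring\<^esub> (scalar c * f)"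
proof -
  interpret ideal I "free_ring :: 'x free_algebra ring"
    unfolding I_def by (rule ideal_Idl)
  have eq: "I +>\<^bsub>free_ring\<^esub> (scalar c * g) = I +>\<^bsub>free_ring\<^esub> (scalar c * f)"
    if "g \<in> I +>\<^bsub>free_ring\<^esub> f" for g
  proof -
    from that obtain h where h: "h \<in> I" "g = h + f"
      by (auto simp: a_r_coset_def' ring_of_type_algebra_def)
    have "scalar c * h \<in> I"
      using I_l_closed[OF h(1), of "scalar c"] by (simp add: ring_of_type_algebra_def)
    hence "scalar c * g \<in> I +>\<^bsub>free_ring\<^esub> (scalar c * f)"
      by (auto simp: h(2) a_r_coset_def' ring_of_type_algebra_def distrib_left)
    thus ?thesis
      using a_repr_independence'[of "scalar c * g" "scalar c * f"]
      by (simp add: ring_of_type_algebra_def)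
  qed
  have "f \<in> I +>\<^bsub>free_ring\<^esub> f"
    using a_rcos_self[of f] by (simp add: ring_of_type_algebra_def)
  hence "(\<Union>g \<in> I +>\<^bsub>free_ring\<^esub> f. I +>\<^bsub>free_ring\<^esub> (scalar c * g)) =
      I +>\<^bsub>free_ring\<^esub> (scalar c * f)"
    by (intro SUP_eq_const eq) blast+
  thus ?thesis
    by (simp only: presented_algebra_def Let_def I_def module.simps)
qed

lemma graded_isomorphic_refl: "graded_isomorphic A A"
proof -
  have "(\<lambda>x. x) \<in> graded_iso A A"
    by (simp add: graded_iso_def ring_iso_def ring_hom_def bij_betw_def inj_on_def)
  thus ?thesis
    unfolding graded_isomorphic_def by blast
qed

lemma sklyanin_in_class:
  "v \<in> sklyanin_params \<Longrightarrow> sklyanin v \<in> sklyanin_iso_class v"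
  by (auto simp: sklyanin_iso_class_def sklyanin_iso_rel_def graded_isomorphic_refl)

lemma signed_perm_closed:
  assumes "bij \<sigma>" "v \<in> sklyanin_params"
  shows "signed_perm \<sigma> v \<in> sklyanin_params"
proof -
  let ?\<tau> = "inv_into UNIV \<sigma>"
  have b: "bij ?\<tau>" using assms(1) by (rule bij_imp_bij_inv)
  have s: "(\<Sum>i\<in>UNIV. v $ ?\<tau> i) = (\<Sum>i\<in>UNIV. v $ i)"
    by (rule sum.reindex_bij_betw[OF b])
  have p: "(\<Prod>i\<in>UNIV. v $ ?\<tau> i) = (\<Prod>i\<in>UNIV. v $ i)"
    by (rule prod.reindex_bij_betw[OF b])
  have prod3: "prod f UNIV = f 1 * f 2 * f 3" for f :: "3 \<Rightarrow> complex"
    unfolding UNIV_3 by (simp add: mult.assoc)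
  have v: "v $ 1 + v $ 2 + v $ 3 + v $ 1 * v $ 2 * v $ 3 = 0"
    using assms(2) by (simp add: sklyanin_params_def)
  have sp: "v $ ?\<tau> 1 + v $ ?\<tau> 2 + v $ ?\<tau> 3 + v $ ?\<tau> 1 * v $ ?\<tau> 2 * v $ ?\<tau> 3 = 0"
    using s p v by (simp add: sum_3 prod3)
  consider "sign \<sigma> = 1" | "sign \<sigma> = - 1" unfolding sign_def by (cases "evenperm \<sigma>") simp_all
  thus ?thesis
  proof cases
    case 1
    thus ?thesis using sp assms(2) by (simp add: signed_perm_def sklyanin_params_def)
  next
    case 2
    have "- v $ ?\<tau> 1 + - v $ ?\<tau> 2 + - v $ ?\<tau> 3 + (- v $ ?\<tau> 1) * (- v $ ?\<tau> 2) * (- v $ ?\<tau> 3)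
        = - (v $ ?\<tau> 1 + v $ ?\<tau> 2 + v $ ?\<tau> 3 + v $ ?\<tau> 1 * v $ ?\<tau> 2 * v $ ?\<tau> 3)"
      by (simp add: algebra_simps)
    with 2 sp assms(2) show ?thesis by (simp add: signed_perm_def sklyanin_params_def)
  qed
qed

lemma extensional_signed_perm: "signed_perm \<sigma> \<in> extensional sklyanin_params"
  by (simp add: signed_perm_def)

lemma group_action_signed_perm: "group_action S3 sklyanin_params signed_perm"
proof -
  have mult: "signed_perm (\<sigma> \<circ> \<tau>) v = signed_perm \<sigma> (signed_perm \<tau> v)"
    if "bij \<sigma>" "bij \<tau>" "v \<in> sklyanin_params" for \<sigma> \<tau> v
  proof -
    have P: "permutation \<sigma>" "permutation \<tau>"
      using that by (simp_all add: permutation)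
    show ?thesis
      using that signed_perm_closed[OF that(2,3)]
      by (simp add: signed_perm_def vec_eq_iff sign_compose[OF P] o_inv_distrib)
  qed
  have id: "signed_perm id v = v" if "v \<in> sklyanin_params" for v
    using that by (simp add: signed_perm_def vec_eq_iff)
  have Bij: "signed_perm \<sigma> \<in> Bij sklyanin_params" if b: "bij \<sigma>" for \<sigma>
  proof -
    have b': "bij (inv_into UNIV \<sigma>)" using b by (rule bij_imp_bij_inv)
    have "bij_betw (signed_perm \<sigma>) sklyanin_params sklyanin_params"
      by (rule bij_betw_byWitness[where f' = "signed_perm (inv_into UNIV \<sigma>)"])
         (use b b' in \<open>auto simp: signed_perm_closed mult[symmetric] id
            bij_is_surj bij_is_inj surj_iff[THEN iffD1] inj_iff[THEN iffD1]\<close>)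
    thus ?thesis by (simp add: Bij_def signed_perm_def)
  qed
  have "signed_perm \<in> hom S3 (BijGroup sklyanin_params)"
  proof (rule homI)
    fix \<sigma> assume "\<sigma> \<in> carrier S3"
    thus "signed_perm \<sigma> \<in> carrier (BijGroup sklyanin_params)"
      using Bij by (simp add: BijGroup_def Bij_def)
  next
    fix \<sigma> \<tau> assume "\<sigma> \<in> carrier S3" "\<tau> \<in> carrier S3"
    hence b: "bij \<sigma>" "bij \<tau>" by (simp_all add: BijGroup_def Bij_def)
    have "signed_perm (\<sigma> \<circ> \<tau>) = compose sklyanin_params (signed_perm \<sigma>) (signed_perm \<tau>)"
      by (rule extensionalityI[of _ sklyanin_params])
         (simp_all add: extensional_signed_perm mult[OF b] compose_def)
    moreover have "compose UNIV \<sigma> \<tau> = \<sigma> \<circ> \<tau>"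
      by (auto simp: compose_def)
    ultimately show "signed_perm (\<sigma> \<otimes>\<^bsub>S3\<^esub> \<tau>) =
        signed_perm \<sigma> \<otimes>\<^bsub>BijGroup sklyanin_params\<^esub> signed_perm \<tau>"
      using b Bij[OF b(1)] Bij[OF b(2)] by (simp add: BijGroup_def Bij_def[of UNIV])
  qed
  thus ?thesis
    by (simp add: group_action_def group_hom_def group_hom_axioms_def group_BijGroup)
qed

lemma signed_perm_cyclic:
  assumes "v \<in> sklyanin_params" "\<sigma> 1 = 2" "\<sigma> 2 = 3" "\<sigma> 3 = (1 :: 3)"
  shows "signed_perm \<sigma> v = vector [v $ 3, v $ 1, v $ 2]"
proof -
  have \<sigma>: "\<sigma> = Transposition.transpose 1 2 \<circ> Transposition.transpose 2 3"
    using assms(2-) by (auto simp: fun_eq_iff forall_3 Transposition.transpose_def)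
  have "sign \<sigma> = 1"
    unfolding \<sigma> by (simp add: sign_compose permutation_swap_id sign_swap_id)
  moreover have "inj \<sigma>" unfolding \<sigma> by (simp add: inj_compose)
  hence "inv_into UNIV \<sigma> 2 = 1" "inv_into UNIV \<sigma> 3 = 2" "inv_into UNIV \<sigma> 1 = 3"
    using assms(2-) by (auto intro: inv_f_eq)
  ultimately show ?thesis
    using assms(1) by (simp add: signed_perm_def vec_eq_iff forall_3)
qed

lemma signed_perm_transposition:
  assumes "v \<in> sklyanin_params"
  shows "signed_perm (Transposition.transpose 1 2) v = vector [- (v $ 2), - (v $ 1), - (v $ 3)]"
proof -
  have "sign (Transposition.transpose 1 (2 :: 3)) = - 1"
    by (simp add: sign_swap_id)
  moreover have "inv_into UNIV (Transposition.transpose 1 (2 :: 3)) = Transposition.transpose 1 2"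
    by (rule inv_equality) simp_all
  ultimately show ?thesis
    using assms by (simp add: signed_perm_def vec_eq_iff forall_3 Transposition.transpose_def)
qed

end

theory Submission
  imports Defs
begin

text \<open>
  Put \<open>t\<^sub>v(0,i) = - v\<^sub>i\<close> and \<open>t\<^sub>v(j,k) = - 1\<close> for \<open>(j,k) = (1,2), (2,3), (3,1)\<close>, and extend
  \<open>t\<^sub>v\<close> antisymmetrically. Up to sign, the six Sklyanin relations say that, for every splitting of
  \<open>{0,1,2,3}\<close> into pairs \<open>{a,b}\<close> and \<open>{c,d}\<close>,
  \<open>x\<^sub>a x\<^sub>b - x\<^sub>b x\<^sub>a + t\<^sub>v(a,b) (x\<^sub>c x\<^sub>d + x\<^sub>d x\<^sub>c) = 0\<close>.
  Thus a quadratic form \<open>M\<close> is a relation if and only if its diagonal vanishes and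
  \<open>M\<^sub>c\<^sub>d + M\<^sub>d\<^sub>c = t\<^sub>v(a,b) (M\<^sub>a\<^sub>b - M\<^sub>b\<^sub>a)\<close> for all splittings.

  A graded isomorphism from the algebra of \<open>v\<close> to the algebra of \<open>w\<close> is a linear substitution
  \<open>x\<^sub>a \<mapsto> \<Sum>\<^sub>m P\<^sub>a\<^sub>m x\<^sub>m\<close> with invertible \<open>P\<close>. By the Leibniz formula some permutation
  \<open>\<pi>\<close> has \<open>P a (\<pi> a) \<noteq> 0\<close> for all \<open>a\<close>. The images of the relations have vanishing diagonal,
  which gives \<open>P\<^sub>0\<^sub>m P\<^sub>i\<^sub>m = 0\<close> and \<open>v\<^sub>i P\<^sub>j\<^sub>m P\<^sub>k\<^sub>m = 0\<close> for \<open>{i,j,k} = {1,2,3}\<close>. So \<open>P\<close> is close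
  enough to a monomial matrix that the coefficients at the positions \<open>\<pi>\<close> satisfy
  \<open>t\<^sub>v(0,i) t\<^sub>v(j,k) = t\<^sub>w(\<pi>0,\<pi>i) t\<^sub>w(\<pi>j,\<pi>k)\<close> (\<open>twist_products_match\<close>).
  For \<open>(i,j,k)\<close> cyclic the left-hand side is \<open>v\<^sub>i\<close>. The right-hand side only depends on \<open>\<pi>\<close> modulo
  the Klein four-group, and the six cosets yield the six elements of the signed orbit of \<open>w\<close>.
  If \<open>v\<^sub>i = 0\<close>, rows \<open>j\<close> and \<open>k\<close> of \<open>P\<close> may mix, but then both sides vanish.

  Conversely, a transposition of the indices 1, 2, 3 together with \<open>x\<^sub>0 \<mapsto> - x\<^sub>0\<close> carries the
  relations of \<open>v\<close> to those of its image under the signed action (\<open>sklyanin_iso_by_involution\<close>),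
  and transpositions generate the symmetric group. Hence two Sklyanin algebras are isomorphic
  if and only if their parameters lie in one orbit, and the theorem follows formally.
\<close>

section \<open>Substitutions and degrees in free algebras\<close>

lemma scalar_simps [simp]: "scalar 0 = 0" "scalar 1 = 1"
  by (simp_all add: scalar_def)

lemma scalar_add: "scalar (a + b) = scalar a + scalar b"
  by (simp add: scalar_def single_add)

lemma scalar_mult: "scalar (a * b) = scalar a * scalar b"
  by (simp add: scalar_def mult_single)

lemma scalar_uminus: "scalar (- a) = - scalar a"
  by (simp add: scalar_def single_uminus)

lemma free_algebra_induct [case_names single add]:
  fixes f :: "'x free_algebra"
  assumes single: "\<And>w c. P (Poly_Mapping.single w c)"
    and add: "\<And>f g. P f \<Longrightarrow> P g \<Longrightarrow> P (f + g)"
  shows "P f"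
proof (induction f rule: Poly_Mapping.update_induct)
  case const
  show ?case using single[of 0 0] by simp
next
  case (update f w c)
  have "Poly_Mapping.update w c f = f + Poly_Mapping.single w c"
    using update by (intro poly_mapping_eqI)
      (auto simp: lookup_add lookup_single lookup_update when_def in_keys_iff)
  thus ?case using add update single by simp
qed

text \<open>
  The product in the free algebra is not commutative, so this is what lets scalars move past words.
\<close>

lemma scalar_central: "scalar c * f = f * scalar c"
  by (induction f rule: free_algebra_induct)
     (simp_all add: scalar_def mult_single algebra_simps)

lemma scalar_left_commute: "f * (scalar c * g) = scalar c * (f * g)"
  by (metis mult.assoc scalar_central)

text \<open>
  The algebra homomorphism given by the universal property of the free algebra: the generator
  \<open>i\<close> goes to \<open>y i\<close>.
\<close>

definition subst :: "('x \<Rightarrow> 'y free_algebra) \<Rightarrow> 'x free_algebra \<Rightarrow> 'y free_algebra"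
  where "subst y f = (\<Sum>w\<in>Poly_Mapping.keys f.
           scalar (Poly_Mapping.lookup f w) * prod_list (map y (letters w)))"

text \<open>
  The support of a sum or product is hard to control; this frees \<open>subst\<close> from the exact support.
\<close>

lemma subst_superset:
  assumes "finite A" "Poly_Mapping.keys f \<subseteq> A"
  shows "subst y f = (\<Sum>w\<in>A. scalar (Poly_Mapping.lookup f w) * prod_list (map y (letters w)))"
  unfolding subst_def using assms by (intro sum.mono_neutral_left) (auto simp: in_keys_iff)

lemma subst_single: "subst y (Poly_Mapping.single w c) = scalar c * prod_list (map y (letters w))"
  by (subst subst_superset[of "{w}"]) auto

lemma subst_add: "subst y (f + g) = subst y f + subst y g"
proof -
  let ?A = "Poly_Mapping.keys f \<union> Poly_Mapping.keys g"
  have "Poly_Mapping.keys (f + g) \<subseteq> ?A" by (rule keys_add)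
  thus ?thesis
    by (simp add: subst_superset[of ?A] lookup_add scalar_add distrib_right sum.distrib)
qed

lemma subst_mult: "subst y (f * g) = subst y f * subst y g"
proof (induction f rule: free_algebra_induct)
  case (single u a)
  show ?case
  proof (induction g rule: free_algebra_induct)
    case (single v b)
    show ?case
      by (simp add: mult_single subst_single plus_word_def scalar_mult mult.assoc
          scalar_left_commute[of "prod_list _"])
  qed (simp add: subst_add distrib_left)
qed (simp add: subst_add distrib_right)

lemma subst_scalar: "subst y (scalar c) = scalar c"
  by (simp add: scalar_def[of c] subst_single) (simp add: scalar_def zero_word_def)

lemma subst_gen: "subst y (gen i) = y i"
  by (simp add: gen_def subst_single)

lemma subst_zero: "subst y 0 = 0"
  by (simp add: subst_def)

lemma subst_one: "subst y 1 = 1"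
  using subst_scalar[of y 1] by simp

lemma subst_uminus: "subst y (- f) = - subst y f"
  using subst_add[of y f "- f"] by (simp add: subst_zero eq_neg_iff_add_eq_0 add.commute)

lemma subst_diff: "subst y (f - g) = subst y f - subst y g"
  using subst_add[of y f "- g"] by (simp add: subst_uminus)

lemmas subst_simps = subst_add subst_mult subst_scalar subst_gen subst_zero subst_one
  subst_uminus subst_diff

lemma subst_prod_list: "subst y (prod_list fs) = prod_list (map (subst y) fs)"
  by (induction fs) (simp_all add: subst_simps)

lemma subst_subst: "subst z (subst y f) = subst (\<lambda>i. subst z (y i)) f"
  by (induction f rule: free_algebra_induct)
     (simp_all add: subst_single subst_simps subst_prod_list o_def)

lemma single_eq_scalar_gens:
  "Poly_Mapping.single w c = scalar c * prod_list (map gen (letters w))"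
proof -
  have "prod_list (map gen xs) = Poly_Mapping.single (Word xs) 1" for xs :: "'a list"
    by (induction xs) (simp_all add: gen_def mult_single plus_word_def zero_word_def[symmetric])
  thus ?thesis by (simp add: scalar_def mult_single)
qed

lemma subst_gen_id: "subst gen f = f"
  by (induction f rule: free_algebra_induct)
     (simp_all only: subst_single subst_add single_eq_scalar_gens[symmetric])

abbreviation word_coeff :: "'x free_algebra \<Rightarrow> 'x list \<Rightarrow> complex"
  where "word_coeff f xs \<equiv> Poly_Mapping.lookup f (Word xs)"

text \<open>
  A word \<open>xs\<close> has exactly one factorisation for each length \<open>k\<close> of the prefix, so the
  convolution product is a finite Cauchy product over \<open>k\<close>.
\<close>

lemma lookup_mult_word:
  "word_coeff (f * g) xs =
    (\<Sum>k\<le>length xs. word_coeff f (take k xs) * word_coeff g (drop k xs))"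
proof (induction f rule: free_algebra_induct)
  case (single u a)
  show ?case
  proof (induction g rule: free_algebra_induct)
    case (single v b)
    have "(\<Sum>k\<le>length xs. word_coeff (Poly_Mapping.single u a) (take k xs) *
             word_coeff (Poly_Mapping.single v b) (drop k xs)) =
          (\<Sum>k\<le>length xs. if k = length (letters u) then a * b when u + v = Word xs else 0)"
    proof (rule sum.cong)
      fix k assume "k \<in> {..length xs}"
      hence k: "k \<le> length xs" by simp
      have split: "u = Word (take k xs) \<and> v = Word (drop k xs) \<longleftrightarrow>
          k = length (letters u) \<and> u + v = Word xs"
      proof
        assume *: "u = Word (take k xs) \<and> v = Word (drop k xs)"
        thus "k = length (letters u) \<and> u + v = Word xs"
          using k by (simp add: plus_word_def)
      next
        assume "k = length (letters u) \<and> u + v = Word xs"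
        thus "u = Word (take k xs) \<and> v = Word (drop k xs)"
          by (cases u; cases v) (auto simp: plus_word_def)
      qed
      have "word_coeff (Poly_Mapping.single u a) (take k xs) *
             word_coeff (Poly_Mapping.single v b) (drop k xs) =
            (a * b when u = Word (take k xs) \<and> v = Word (drop k xs))"
        by (auto simp: lookup_single when_def)
      also have "\<dots> = (if k = length (letters u) then a * b when u + v = Word xs else 0)"
        unfolding split by (simp add: when_def)
      finally show "word_coeff (Poly_Mapping.single u a) (take k xs) *
             word_coeff (Poly_Mapping.single v b) (drop k xs) =
            (if k = length (letters u) then a * b when u + v = Word xs else 0)" .
    qed simp
    also have "\<dots> = (a * b when u + v = Word xs)"
      by (cases u; cases v) (auto simp: when_def plus_word_def)
    finally show ?case
      by (simp add: mult_single lookup_single)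
  qed (simp add: lookup_add distrib_left sum.distrib)
qed (simp add: lookup_add distrib_right sum.distrib)

lemma lookup_mult_short:
  "word_coeff (f * g) [] = word_coeff f [] * word_coeff g []"
  "word_coeff (f * g) [i] =
     word_coeff f [] * word_coeff g [i] + word_coeff f [i] * word_coeff g []"
  "word_coeff (f * g) [i, j] =
     word_coeff f [] * word_coeff g [i, j] + word_coeff f [i] * word_coeff g [j] +
     word_coeff f [i, j] * word_coeff g []"
  by (simp_all add: lookup_mult_word)

lemma lookup_scalar_mult: "Poly_Mapping.lookup (scalar c * f) w = c * Poly_Mapping.lookup f w"
  by (induction f rule: free_algebra_induct)
     (simp_all add: scalar_def mult_single lookup_single lookup_add distrib_left when_def)

lemma lookup_gen: "word_coeff (gen i) [j] = (if i = j then 1 else 0)"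
  "word_coeff (gen i) [] = 0" "word_coeff (gen i) [j,k] = 0"
  by (auto simp: gen_def lookup_single)

lemma homogeneous_lookup:
  "f \<in> homogeneous n \<longleftrightarrow> (\<forall>xs. length xs \<noteq> n \<longrightarrow> word_coeff f xs = 0)"
proof
  assume "f \<in> homogeneous n"
  thus "\<forall>xs. length xs \<noteq> n \<longrightarrow> word_coeff f xs = 0"
    by (force simp: homogeneous_def in_keys_iff)
next
  assume *: "\<forall>xs. length xs \<noteq> n \<longrightarrow> word_coeff f xs = 0"
  have "length (letters w) = n" if "w \<in> Poly_Mapping.keys f" for w
    using that *[rule_format, of "letters w"] by (auto simp: in_keys_iff)
  thus "f \<in> homogeneous n"
    by (simp add: homogeneous_def)
qed

lemma gen_homogeneous: "gen i \<in> homogeneous 1"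
  by (auto simp: homogeneous_def gen_def)

text \<open>
  A linear form is determined by its coefficients at words of length one; finiteness of the
  alphabet makes the right-hand side a genuine sum.
\<close>

lemma linear_form_expansion:
  fixes l :: "'x::finite free_algebra"
  assumes "l \<in> homogeneous 1"
  shows "l = (\<Sum>i\<in>UNIV. scalar (word_coeff l [i]) * gen i)"
proof (rule poly_mapping_eqI)
  fix w :: "'x word"
  show "Poly_Mapping.lookup l w = Poly_Mapping.lookup (\<Sum>i\<in>UNIV. scalar (word_coeff l [i]) * gen i) w"
  proof (cases "\<exists>i. w = Word [i]")
    case True
    thus ?thesis by (auto simp: lookup_sum lookup_scalar_mult lookup_gen if_distrib[of "(*) _"] cong: if_cong)
  next
    case False
    hence "length (letters w) \<noteq> 1" by (cases w) (auto simp: length_Suc_conv)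
    thus ?thesis using False assms
      by (cases w) (auto simp: homogeneous_lookup lookup_sum lookup_scalar_mult gen_def
          lookup_single when_def intro!: sum.neutral)
  qed
qed

lemma homogeneous_add: "f \<in> homogeneous n \<Longrightarrow> g \<in> homogeneous n \<Longrightarrow> f + g \<in> homogeneous n"
  by (simp add: homogeneous_lookup lookup_add)

lemma homogeneous_diff: "f \<in> homogeneous n \<Longrightarrow> g \<in> homogeneous n \<Longrightarrow> f - g \<in> homogeneous n"
  by (simp add: homogeneous_lookup lookup_minus)

lemma homogeneous_uminus: "f \<in> homogeneous n \<Longrightarrow> - f \<in> homogeneous n"
  by (simp add: homogeneous_lookup)

lemma homogeneous_scalar_mult: "f \<in> homogeneous n \<Longrightarrow> scalar c * f \<in> homogeneous n"
  by (simp add: homogeneous_lookup lookup_scalar_mult)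

lemma homogeneous_zero: "0 \<in> homogeneous n"
  by (simp add: homogeneous_lookup)

lemma homogeneous_mult:
  assumes "f \<in> homogeneous m" "g \<in> homogeneous n"
  shows "f * g \<in> homogeneous (m + n)"
  unfolding homogeneous_lookup
proof (intro allI impI)
  fix xs :: "'a list" assume xs: "length xs \<noteq> m + n"
  have "word_coeff f (take k xs) * word_coeff g (drop k xs) = 0" if "k \<le> length xs" for k
    using assms xs that by (cases "k = m") (auto simp: homogeneous_lookup)
  thus "word_coeff (f * g) xs = 0"
    by (auto simp: lookup_mult_word intro!: sum.neutral)
qed

lemma homogeneous_subst:
  assumes "\<And>i. y i \<in> homogeneous 1" "f \<in> homogeneous n"
  shows "subst y f \<in> homogeneous n"
proof -
  have prod: "prod_list (map y xs) \<in> homogeneous (length xs)" for xs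
  proof (induction xs)
    case Nil
    show ?case by (auto simp: homogeneous_def zero_word_def keys_one)
  next
    case (Cons x xs)
    thus ?case using homogeneous_mult[OF assms(1)[of x]] by simp
  qed
  have "(\<Sum>w\<in>A. scalar (Poly_Mapping.lookup f w) * prod_list (map y (letters w))) \<in> homogeneous n"
    if "finite A" "A \<subseteq> Poly_Mapping.keys f" for A
    using that
  proof (induction A rule: finite_induct)
    case (insert w A)
    hence "length (letters w) = n" using assms(2) by (auto simp: homogeneous_def)
    thus ?case using insert prod[of "letters w"]
      by (auto intro!: homogeneous_add homogeneous_scalar_mult)
  qed (simp add: homogeneous_zero)
  thus ?thesis by (simp add: subst_def)
qed

lemma subst_sum: "subst y (\<Sum>i\<in>A. f i) = (\<Sum>i\<in>A. subst y (f i))"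
  by (induction A rule: infinite_finite_induct) (simp_all add: subst_simps)

lemma homogeneous_sum: "(\<And>i. i \<in> A \<Longrightarrow> f i \<in> homogeneous n) \<Longrightarrow> (\<Sum>i\<in>A. f i) \<in> homogeneous n"
  by (induction A rule: infinite_finite_induct) (simp_all add: homogeneous_zero homogeneous_add)

section \<open>Presented algebras\<close>

abbreviation relation_ideal :: "'x free_algebra set \<Rightarrow> 'x free_algebra set"
  where "relation_ideal R \<equiv> Idl\<^bsub>free_ring\<^esub> R"

abbreviation coset :: "'x free_algebra set \<Rightarrow> 'x free_algebra \<Rightarrow> 'x free_algebra set"
  where "coset R f \<equiv> relation_ideal R +>\<^bsub>free_ring\<^esub> f"

lemma free_ring_simps [simp]:
  "carrier (free_ring :: 'x free_algebra ring) = UNIV"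
  "x \<otimes>\<^bsub>free_ring\<^esub> y = x * (y :: 'x free_algebra)"
  "x \<oplus>\<^bsub>free_ring\<^esub> y = x + (y :: 'x free_algebra)"
  "\<one>\<^bsub>free_ring\<^esub> = (1 :: 'x free_algebra)"
  "\<zero>\<^bsub>free_ring\<^esub> = (0 :: 'x free_algebra)"
  by (simp_all add: ring_of_type_algebra_def)

lemma relation_ideal_superset: "R \<subseteq> relation_ideal R"
  by (rule ring.genideal_self[OF ring_free_ring]) simp

lemma relation_ideal_closed:
  fixes R :: "'x free_algebra set"
  shows relation_ideal_zero: "0 \<in> relation_ideal R"
    and relation_ideal_add: "f \<in> relation_ideal R \<Longrightarrow> g \<in> relation_ideal R \<Longrightarrow> f + g \<in> relation_ideal R"
    and relation_ideal_mult_left: "f \<in> relation_ideal R \<Longrightarrow> g * f \<in> relation_ideal R"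
    and relation_ideal_mult_right: "f \<in> relation_ideal R \<Longrightarrow> f * g \<in> relation_ideal R"
    and relation_ideal_uminus: "f \<in> relation_ideal R \<Longrightarrow> - f \<in> relation_ideal R"
proof -
  interpret ideal "relation_ideal R" "free_ring :: 'x free_algebra ring"
    by (rule ideal_Idl)
  show "0 \<in> relation_ideal R"
    using additive_subgroup.zero_closed[OF ideal.axioms(1)[OF ideal_Idl[of R]]] by simp
  show "f \<in> relation_ideal R \<Longrightarrow> g \<in> relation_ideal R \<Longrightarrow> f + g \<in> relation_ideal R"
    using additive_subgroup.a_closed[OF ideal.axioms(1)[OF ideal_Idl[of R]]] by simp
  show *: "f \<in> relation_ideal R \<Longrightarrow> g * f \<in> relation_ideal R" for g
    using I_l_closed by simp
  show "f \<in> relation_ideal R \<Longrightarrow> f * g \<in> relation_ideal R"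
    using I_r_closed by simp
  show "f \<in> relation_ideal R \<Longrightarrow> - f \<in> relation_ideal R"
    using *[of "- 1"] by simp
qed

text \<open>
  Closure of \<open>J\<close> under negation comes from \<open>- f = (- 1) * f\<close>.
\<close>

lemma relation_ideal_least:
  assumes "R \<subseteq> J" "0 \<in> J" "\<And>f g. f \<in> J \<Longrightarrow> g \<in> J \<Longrightarrow> f + g \<in> J"
    "\<And>f g. f \<in> J \<Longrightarrow> g * f \<in> J" "\<And>f g. f \<in> J \<Longrightarrow> f * g \<in> J"
  shows "relation_ideal R \<subseteq> J"
proof (rule ring.genideal_minimal[OF ring_free_ring _ assms(1)])
  have neg: "- f \<in> J" if "f \<in> J" for f
    using assms(4)[OF that, of "- 1"] by simp
  have inv: "\<ominus>\<^bsub>free_ring\<^esub> f = - f" for f :: "'a free_algebra"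
    using abelian_group.minus_equality[of "free_ring :: 'a free_algebra ring" "- f" f]
      ring.is_abelian_group[OF ring_free_ring] by simp
  show "ideal J free_ring"
  proof (rule idealI[OF ring_free_ring])
    show "subgroup J (add_monoid free_ring)"
    proof (rule subgroup.intro)
      show "inv\<^bsub>add_monoid free_ring\<^esub> f \<in> J" if "f \<in> J" for f
        using neg[OF that] inv[of f] by (simp only: a_inv_def)
    qed (use assms in auto)
  qed (use assms in auto)
qed

lemma mem_coset_iff: "f \<in> coset R g \<longleftrightarrow> f - g \<in> relation_ideal R"
proof
  assume "f - g \<in> relation_ideal R"
  thus "f \<in> coset R g"
    by (auto simp: a_r_coset_def' intro!: bexI[of _ "f - g"])
qed (auto simp: a_r_coset_def')

lemma coset_eq_iff:
  fixes R :: "'x free_algebra set"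
  shows "coset R f = coset R g \<longleftrightarrow> f - g \<in> relation_ideal R"
proof -
  interpret ideal "relation_ideal R" "free_ring :: 'x free_algebra ring"
    by (rule ideal_Idl)
  have "f \<in> coset R f" using a_rcos_self[of f] by simp
  thus ?thesis
    using a_repr_independence'[of f g] mem_coset_iff[of f R g] by auto
qed

lemma presented_algebra_simps:
  fixes R :: "'x free_algebra set"
  shows carrier_presented: "carrier (presented_algebra R) = range (coset R)"
    and mult_presented: "coset R f \<otimes>\<^bsub>presented_algebra R\<^esub> coset R g = coset R (f * g)"
    and add_presented: "coset R f \<oplus>\<^bsub>presented_algebra R\<^esub> coset R g = coset R (f + g)"
    and one_presented: "\<one>\<^bsub>presented_algebra R\<^esub> = coset R 1"
    and part_presented: "part (presented_algebra R) n = coset R ` homogeneous n"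
proof -
  interpret ideal "relation_ideal R" "free_ring :: 'x free_algebra ring"
    by (rule ideal_Idl)
  show "carrier (presented_algebra R) = range (coset R)"
    by (auto simp: presented_algebra_def Let_def FactRing_def A_RCOSETS_def' )
  show "coset R f \<otimes>\<^bsub>presented_algebra R\<^esub> coset R g = coset R (f * g)"
    using rcoset_mult_add[of f g] by (simp add: presented_algebra_def Let_def FactRing_def)
  show "coset R f \<oplus>\<^bsub>presented_algebra R\<^esub> coset R g = coset R (f + g)"
    using a_rcos_sum[of f g] by (simp add: presented_algebra_def Let_def FactRing_def)
  show "\<one>\<^bsub>presented_algebra R\<^esub> = coset R 1" "part (presented_algebra R) n = coset R ` homogeneous n"
    by (simp_all add: presented_algebra_def Let_def FactRing_def)
qed

lemma subst_relation_ideal: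
  assumes "\<And>r. r \<in> R \<Longrightarrow> subst y r \<in> relation_ideal S" "f \<in> relation_ideal R"
  shows "subst y f \<in> relation_ideal S"
proof -
  have "relation_ideal R \<subseteq> subst y -` relation_ideal S"
    by (rule relation_ideal_least)
       (auto simp: assms(1) subst_simps relation_ideal_zero intro: relation_ideal_add
          relation_ideal_mult_left relation_ideal_mult_right)
  thus ?thesis using assms(2) by auto
qed

text \<open>
  Taking images under the substitution maps cosets to cosets, because the inverse substitution
  respects the ideals as well; so the isomorphism can be taken to be the image map itself.
\<close>

lemma graded_isomorphic_by_substitution:
  fixes R :: "'x free_algebra set" and S :: "'y free_algebra set"
  assumes y: "\<And>i. y i \<in> homogeneous 1" "\<And>r. r \<in> R \<Longrightarrow> subst y r \<in> relation_ideal S"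
    and z: "\<And>i. z i \<in> homogeneous 1" "\<And>s. s \<in> S \<Longrightarrow> subst z s \<in> relation_ideal R"
    and zy: "\<And>i. subst z (y i) = gen i" and yz: "\<And>i. subst y (z i) = gen i"
  shows "graded_isomorphic (presented_algebra R) (presented_algebra S)"
proof -
  have inv: "subst z (subst y f) = f" "subst y (subst z g) = g" for f g
    by (simp_all add: subst_subst zy yz subst_gen_id)
  note ideal_y = subst_relation_ideal[of R y S, OF y(2)]
  note ideal_z = subst_relation_ideal[of S z R, OF z(2)]
  have image: "subst y ` coset R f = coset S (subst y f)" for f
  proof (intro equalityI subsetI)
    fix g assume "g \<in> subst y ` coset R f"
    thus "g \<in> coset S (subst y f)"
      using ideal_y by (auto simp: mem_coset_iff subst_diff[symmetric])
  next
    fix g assume "g \<in> coset S (subst y f)"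
    hence "subst z (g - subst y f) \<in> relation_ideal R"
      by (intro ideal_z mem_coset_iff[THEN iffD1])
    hence "subst z g \<in> coset R f"
      by (simp add: mem_coset_iff subst_diff inv)
    thus "g \<in> subst y ` coset R f"
      by (metis imageI inv(2))
  qed
  let ?A = "presented_algebra R" and ?B = "presented_algebra S"
  have surj: "range (subst y) = UNIV"
    by (metis inv(2) surjI)
  have "inj (subst y)" by (metis inv(1) injI)
  hence "inj_on (image (subst y)) (carrier ?A)"
    by (simp add: inj_on_def inj_image_eq_iff)
  moreover have "image (subst y) ` carrier ?A = carrier ?B"
  proof -
    have "coset S ` range (subst y) = carrier ?B"
      by (simp add: surj carrier_presented)
    thus ?thesis
      by (simp add: carrier_presented image_image image)
  qed
  moreover have "image (subst y) \<in> ring_hom ?A ?B"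
  proof (rule ring_hom_memI)
    fix C D assume "C \<in> carrier ?A" "D \<in> carrier ?A"
    then obtain f g where [simp]: "C = coset R f" "D = coset R g"
      by (auto simp: carrier_presented)
    show "subst y ` C \<in> carrier ?B"
      by (simp add: carrier_presented image)
    show "subst y ` (C \<otimes>\<^bsub>?A\<^esub> D) = subst y ` C \<otimes>\<^bsub>?B\<^esub> subst y ` D"
      "subst y ` (C \<oplus>\<^bsub>?A\<^esub> D) = subst y ` C \<oplus>\<^bsub>?B\<^esub> subst y ` D"
      by (simp_all add: mult_presented add_presented image subst_simps)
  qed (simp add: one_presented image subst_simps)
  moreover have "image (subst y) ` part ?A n = part ?B n" for n
  proof -
    have "subst y ` homogeneous n = homogeneous n"
      using homogeneous_subst[of y _ n] homogeneous_subst[of z _ n] y(1) z(1)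
      by (auto simp: image_iff) (metis inv(2))
    hence "coset S ` homogeneous n = coset S ` subst y ` homogeneous n" by simp
    thus ?thesis by (auto simp: part_presented image image_image)
  qed
  moreover have "subst y ` (c \<odot>\<^bsub>?A\<^esub> C) = c \<odot>\<^bsub>?B\<^esub> (subst y ` C)" if "C \<in> carrier ?A" for c C
  proof -
    from that obtain f where "C = coset R f"
      by (auto simp: carrier_presented)
    thus ?thesis
      by (simp add: smult_presented_algebra image subst_simps)
  qed
  ultimately have "image (subst y) \<in> graded_iso ?A ?B"
    by (auto simp: graded_iso_def ring_iso_def bij_betw_def)
  thus ?thesis
    unfolding graded_isomorphic_def by blast
qed

text \<open>
  An isomorphism that preserves degrees sends each generator to the class of a linear form, and
  its values on all classes are then forced, since the generators generate. Injectivity turns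
  the induced inclusion of ideals into an equivalence.
\<close>

lemma graded_iso_is_substitution:
  fixes R :: "'x free_algebra set" and S :: "'y free_algebra set"
  assumes "h \<in> graded_iso (presented_algebra R) (presented_algebra S)"
  shows "\<exists>l. (\<forall>i. l i \<in> homogeneous 1) \<and>
    (\<forall>f. f \<in> relation_ideal R \<longleftrightarrow> subst l f \<in> relation_ideal S)"
proof -
  let ?A = "presented_algebra R" and ?B = "presented_algebra S"
  have hom: "h \<in> ring_hom ?A ?B" and inj: "inj_on h (carrier ?A)"
    and smult: "\<And>c C. C \<in> carrier ?A \<Longrightarrow> h (c \<odot>\<^bsub>?A\<^esub> C) = c \<odot>\<^bsub>?B\<^esub> h C"
    and part: "h ` part ?A 1 = part ?B 1"
    using assms by (auto simp: graded_iso_def ring_iso_def bij_betw_def)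
  have h_add: "h (coset R (f + g)) = h (coset R f) \<oplus>\<^bsub>?B\<^esub> h (coset R g)" for f g
    using ring_hom_add[OF hom, of "coset R f" "coset R g"]
    by (simp add: carrier_presented add_presented)
  have h_mult: "h (coset R (f * g)) = h (coset R f) \<otimes>\<^bsub>?B\<^esub> h (coset R g)" for f g
    using ring_hom_mult[OF hom, of "coset R f" "coset R g"]
    by (simp add: carrier_presented mult_presented)
  have h_one: "h (coset R 1) = coset S 1"
    using ring_hom_one[OF hom] by (simp add: one_presented)
  have h_scalar: "h (coset R (scalar c * f)) = c \<odot>\<^bsub>?B\<^esub> h (coset R f)" for c f
    using smult[of "coset R f" c] by (simp add: carrier_presented smult_presented_algebra)
  have "\<exists>l \<in> homogeneous 1. h (coset R (gen i)) = coset S l" for i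
  proof -
    have "h (coset R (gen i)) \<in> h ` part ?A 1"
      by (auto simp: part_presented gen_homogeneous[simplified])
    thus ?thesis unfolding part by (auto simp: part_presented)
  qed
  then obtain l where l: "\<And>i. l i \<in> homogeneous 1" "\<And>i. h (coset R (gen i)) = coset S (l i)"
    by metis
  have word: "h (coset R (prod_list (map gen xs))) = coset S (prod_list (map l xs))" for xs
    by (induction xs) (simp_all add: h_one h_mult l mult_presented)
  have h: "h (coset R f) = coset S (subst l f)" for f
  proof (induction f rule: free_algebra_induct)
    case (single w c)
    show ?case
      by (simp add: subst_single single_eq_scalar_gens[of w] subst_simps subst_prod_list o_def
          h_scalar word smult_presented_algebra)
  qed (simp add: h_add subst_add add_presented)
  have "f \<in> relation_ideal R \<longleftrightarrow> subst l f \<in> relation_ideal S" for f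
  proof -
    have "f \<in> relation_ideal R \<longleftrightarrow> coset R f = coset R 0"
      by (simp add: coset_eq_iff)
    also have "\<dots> \<longleftrightarrow> h (coset R f) = h (coset R 0)"
      using inj_on_eq_iff[OF inj, of "coset R f" "coset R 0"] by (auto simp: carrier_presented)
    also have "\<dots> \<longleftrightarrow> subst l f \<in> relation_ideal S"
      by (simp add: h coset_eq_iff subst_zero)
    finally show ?thesis .
  qed
  with l(1) show ?thesis by blast
qed

text \<open>
  The ideal generated by quadratic elements starts in degree two, and there it is only the
  linear span of the generators: a product with an element of positive degree lives in degree at least three.
\<close>

lemma relation_ideal_quadratic:
  assumes R: "\<And>r. r \<in> R \<Longrightarrow> r \<in> homogeneous 2" "\<And>r. r \<in> R \<Longrightarrow> (\<lambda>i j. word_coeff r [i, j]) \<in> W"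
    and W: "(\<lambda>i j. 0) \<in> W" "\<And>M N. M \<in> W \<Longrightarrow> N \<in> W \<Longrightarrow> (\<lambda>i j. M i j + N i j) \<in> W"
      "\<And>M c. M \<in> W \<Longrightarrow> (\<lambda>i j. c * M i j) \<in> W"
    and f: "f \<in> relation_ideal R"
  shows "word_coeff f [i] = 0" "(\<lambda>i j. word_coeff f [i, j]) \<in> W"
proof -
  let ?J = "{f. word_coeff f [] = 0 \<and> (\<forall>i. word_coeff f [i] = 0) \<and>
              (\<lambda>i j. word_coeff f [i, j]) \<in> W}"
  have "relation_ideal R \<subseteq> ?J"
  proof (rule relation_ideal_least)
    show "R \<subseteq> ?J" using R by (auto simp: homogeneous_lookup)
  next
    fix f g assume "f \<in> ?J"
    thus "f * g \<in> ?J" using W(3)[of "\<lambda>i j. word_coeff f [i, j]" "word_coeff g []"]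
      by (simp add: lookup_mult_short mult.commute)
  qed (use W in \<open>auto simp: lookup_mult_short lookup_add\<close>)
  thus "word_coeff f [i] = 0" "(\<lambda>i j. word_coeff f [i, j]) \<in> W" using f by auto
qed

section \<open>The twist of a pair of generators\<close>

lemma all_4: "(\<forall>i::4. P i) \<longleftrightarrow> P 0 \<and> P 1 \<and> P 2 \<and> P 3"
proof -
  \<comment> \<open>The numerals of this type are residues modulo 4.\<close>
  have "(4::4) = 0" by simp
  thus ?thesis using forall_4[of P] by metis
qed

text \<open>
  The position in \<open>v\<close> of the parameter that belongs to the generator \<open>x\<^sub>a\<close>, for \<open>a \<noteq> 0\<close>;
  the value at \<open>0\<close> is a default.
\<close>

definition index :: "4 \<Rightarrow> 3"
  where "index a = (if a = 1 then 1 else if a = 2 then 2 else 3)"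

text \<open>
  The antisymmetric matrix that packages the parameters with the constants \<open>\<plusminus>1\<close> of the
  relations \<open>s\<^sub>i\<close>; it is antisymmetric off the diagonal.
\<close>

definition twist :: "complex ^ 3 \<Rightarrow> 4 \<Rightarrow> 4 \<Rightarrow> complex"
  where "twist v a b =
    (if a = 0 then - (v $ index b) else if b = 0 then v $ index a
     else if (a, b) \<in> {(1, 2), (2, 3), (3, 1)} then - 1 else 1)"

definition twisted_commutator :: "complex ^ 3 \<Rightarrow> 4 \<Rightarrow> 4 \<Rightarrow> 4 \<Rightarrow> 4 \<Rightarrow> 4 free_algebra"
  where "twisted_commutator v a b c d =
    gen a * gen b - gen b * gen a + scalar (twist v a b) * (gen c * gen d + gen d * gen c)"

lemma twist_values:
  "twist v 0 1 = - (v $ 1)" "twist v 0 2 = - (v $ 2)" "twist v 0 3 = - (v $ 3)"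
  "twist v 1 0 = v $ 1" "twist v 2 0 = v $ 2" "twist v 3 0 = v $ 3"
  "twist v 1 2 = - 1" "twist v 2 3 = - 1" "twist v 3 1 = - 1"
  "twist v 2 1 = 1" "twist v 3 2 = 1" "twist v 1 3 = 1"
  by (simp_all add: twist_def index_def)

lemma twist_swap: "a \<noteq> b \<Longrightarrow> twist v b a = - twist v a b"
proof -
  have "\<forall>a b. a \<noteq> b \<longrightarrow> twist v b a = - twist v a b"
    by (simp add: all_4 twist_values)
  thus "a \<noteq> b \<Longrightarrow> twist v b a = - twist v a b" by blast
qed

text \<open>
  Every arrangement of the four indices arises from one of the six ordered splittings by
  exchanging the members of each pair, so a symmetric property needs only six checks.
\<close>

lemma pair_splitting_cases:
  fixes P :: "4 \<Rightarrow> 4 \<Rightarrow> 4 \<Rightarrow> 4 \<Rightarrow> bool"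
  assumes base: "P 0 1 2 3" "P 0 2 3 1" "P 0 3 1 2" "P 2 3 0 1" "P 3 1 0 2" "P 1 2 0 3"
    and swap_left: "\<And>a b c d. a \<noteq> b \<Longrightarrow> P a b c d \<Longrightarrow> P b a c d"
    and swap_right: "\<And>a b c d. P a b c d \<Longrightarrow> P a b d c"
    and "distinct [a, b, c, d]"
  shows "P a b c d"
proof -
  note left = base[THEN swap_left[rotated], simplified]
  note right = base[THEN swap_right] left[THEN swap_right]
  have "\<forall>a b c d. distinct [a, b, c, d] \<longrightarrow> P a b c d"
    by (simp add: all_4 base left right)
  thus ?thesis using assms(9) by blast
qed

text \<open>
  Putting a pair \<open>{0, i}\<close> first gives \<open>r\<^sub>i\<close>, and putting it second gives \<open>- s\<^sub>i\<close>.
\<close>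

lemma sklyanin_relations_eq:
  "sklyanin_relations v =
    {twisted_commutator v 0 1 2 3, - twisted_commutator v 2 3 0 1,
     twisted_commutator v 0 2 3 1, - twisted_commutator v 3 1 0 2,
     twisted_commutator v 0 3 1 2, - twisted_commutator v 1 2 0 3}"
  unfolding sklyanin_relations_def Let_def twisted_commutator_def twist_values
  by (simp add: scalar_uminus algebra_simps)

lemma twisted_commutator_in_ideal:
  assumes "distinct [a, b, c, d]"
  shows "twisted_commutator v a b c d \<in> relation_ideal (sklyanin_relations v)"
proof -
  let ?I = "relation_ideal (sklyanin_relations v)" and ?t = "twisted_commutator v"
  have base: "r \<in> ?I" if "r \<in> sklyanin_relations v" for r
    using that relation_ideal_superset by blast
  have swap_left: "?t b a c d \<in> ?I" if "?t a b c d \<in> ?I" "a \<noteq> b" for a b c d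
  proof -
    have "?t b a c d = - ?t a b c d"
      using twist_swap[OF that(2), of v]
      by (simp add: twisted_commutator_def scalar_uminus algebra_simps)
    thus ?thesis using relation_ideal_uminus[OF that(1)] by simp
  qed
  have swap_right: "?t a b d c = ?t a b c d" for a b c d
    by (simp add: twisted_commutator_def algebra_simps)
  have r: "?t 0 1 2 3 \<in> ?I" "?t 0 2 3 1 \<in> ?I" "?t 0 3 1 2 \<in> ?I"
    by (rule base, simp add: sklyanin_relations_eq)+
  have "- ?t 2 3 0 1 \<in> ?I" "- ?t 3 1 0 2 \<in> ?I" "- ?t 1 2 0 3 \<in> ?I"
    by (rule base, simp add: sklyanin_relations_eq)+
  hence s: "?t 2 3 0 1 \<in> ?I" "?t 3 1 0 2 \<in> ?I" "?t 1 2 0 3 \<in> ?I"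
    using relation_ideal_uminus by fastforce+
  show ?thesis
    by (rule pair_splitting_cases[of "\<lambda>a b c d. ?t a b c d \<in> ?I", OF r s _ _ assms])
       (simp_all add: swap_left swap_right)
qed

section \<open>The quadratic part of the Sklyanin ideal\<close>

text \<open>
  Coefficient matrices of the quadratic relations, described by linear equations instead of
  generators: membership of an unknown matrix can then be used through its entries.
\<close>

definition sklyanin_quadrics :: "complex ^ 3 \<Rightarrow> (4 \<Rightarrow> 4 \<Rightarrow> complex) set"
  where "sklyanin_quadrics v = {M. (\<forall>a. M a a = 0) \<and>
    (\<forall>a b c d. distinct [a, b, c, d] \<longrightarrow> M c d + M d c = twist v a b * (M a b - M b a))}"

lemma sklyanin_quadricsI:
  assumes "\<And>a. M a a = 0"
    and "M 2 3 + M 3 2 = twist v 0 1 * (M 0 1 - M 1 0)"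
    and "M 3 1 + M 1 3 = twist v 0 2 * (M 0 2 - M 2 0)"
    and "M 1 2 + M 2 1 = twist v 0 3 * (M 0 3 - M 3 0)"
    and "M 0 1 + M 1 0 = twist v 2 3 * (M 2 3 - M 3 2)"
    and "M 0 2 + M 2 0 = twist v 3 1 * (M 3 1 - M 1 3)"
    and "M 0 3 + M 3 0 = twist v 1 2 * (M 1 2 - M 2 1)"
  shows "M \<in> sklyanin_quadrics v"
proof -
  have "M c d + M d c = twist v a b * (M a b - M b a)" if "distinct [a, b, c, d]" for a b c d
  proof (rule pair_splitting_cases[of "\<lambda>a b c d. M c d + M d c = twist v a b * (M a b - M b a)",
             OF assms(2-) _ _ that])
    fix a b c d assume "a \<noteq> b" "M c d + M d c = twist v a b * (M a b - M b a)"
    thus "M c d + M d c = twist v b a * (M b a - M a b)"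
      by (simp add: twist_swap[of a b] algebra_simps)
  qed (simp add: add.commute)
  thus ?thesis using assms(1) by (simp add: sklyanin_quadrics_def)
qed

text \<open>
  The matrix \<open>P\<close> of a linear substitution acts on coefficient matrices as \<open>M \<mapsto> P\<^sup>T M P\<close>,
  written out here for the Sklyanin relations.
\<close>

lemma coeff_twisted_commutator:
  "(\<lambda>x y. word_coeff (subst l (twisted_commutator v a b c d)) [x, y]) =
   (\<lambda>x y. P a x * P b y - P b x * P a y + twist v a b * (P c x * P d y + P d x * P c y))"
  if "\<And>a. l a \<in> homogeneous 1" "\<And>a x. word_coeff (l a) [x] = P a x"
proof -
  have "word_coeff (l a) [] = 0" for a using that(1) by (simp add: homogeneous_lookup)
  thus ?thesis using that(2)
    unfolding twisted_commutator_def subst_simps lookup_add lookup_minus lookup_scalar_mult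
      lookup_mult_short by (simp add: scalar_def lookup_single zero_word_def)
qed

lemma twisted_commutator_homogeneous: "twisted_commutator v a b c d \<in> homogeneous 2"
proof -
  have "gen i * gen j \<in> homogeneous 2" for i j :: 4
    using homogeneous_mult[OF gen_homogeneous gen_homogeneous, of i j] by (simp add: numeral_2_eq_2)
  thus ?thesis unfolding twisted_commutator_def
    by (intro homogeneous_add homogeneous_diff homogeneous_scalar_mult)
qed

lemma sklyanin_relations_quadrics:
  assumes "r \<in> sklyanin_relations v"
  shows "(\<lambda>x y. word_coeff r [x, y]) \<in> sklyanin_quadrics v"
proof -
  have coeff: "word_coeff (twisted_commutator v a b c d) [x, y] =
      (if x = a \<and> y = b then 1 else 0) - (if x = b \<and> y = a then 1 else 0) +
      twist v a b * ((if x = c \<and> y = d then 1 else 0) + (if x = d \<and> y = c then 1 else 0))"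
    for a b c d x y
  proof -
    have "word_coeff (gen i * gen j) [x, y] = (if x = i \<and> y = j then 1 else 0)" for i j :: 4
      by (auto simp: lookup_mult_short lookup_gen)
    thus ?thesis
      by (simp only: twisted_commutator_def lookup_add lookup_minus lookup_scalar_mult)
  qed
  have diag: "word_coeff (twisted_commutator v a b c d) [x, x] = 0" if "a \<noteq> b" "c \<noteq> d" for a b c d x
    using that by (auto simp: coeff)
  show ?thesis using assms unfolding sklyanin_relations_eq
    by (elim insertE emptyE; intro sklyanin_quadricsI)
       (simp_all add: diag, simp_all add: coeff twist_values)
qed

lemma relation_ideal_sklyanin:
  assumes "f \<in> relation_ideal (sklyanin_relations v)"
  shows "word_coeff f [i] = 0" "(\<lambda>x y. word_coeff f [x, y]) \<in> sklyanin_quadrics v"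
proof -
  have hom: "r \<in> homogeneous 2" if "r \<in> sklyanin_relations v" for r
    using that by (auto simp: sklyanin_relations_eq intro!: homogeneous_uminus
        twisted_commutator_homogeneous)
  have W: "(\<lambda>i j. 0) \<in> sklyanin_quadrics v"
    "\<And>M N. M \<in> sklyanin_quadrics v \<Longrightarrow> N \<in> sklyanin_quadrics v \<Longrightarrow>
       (\<lambda>i j. M i j + N i j) \<in> sklyanin_quadrics v"
    "\<And>M c. M \<in> sklyanin_quadrics v \<Longrightarrow> (\<lambda>i j. c * M i j) \<in> sklyanin_quadrics v"
  proof -
    show "(\<lambda>i j. 0) \<in> sklyanin_quadrics v"
      by (simp add: sklyanin_quadrics_def)
  next
    fix M N assume "M \<in> sklyanin_quadrics v" "N \<in> sklyanin_quadrics v"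
    hence "M a a = 0" "N a a = 0"
      "distinct [a, b, c, d] \<Longrightarrow> (M c d + M d c) + (N c d + N d c) =
         twist v a b * (M a b - M b a) + twist v a b * (N a b - N b a)" for a b c d
      by (auto simp: sklyanin_quadrics_def)
    thus "(\<lambda>i j. M i j + N i j) \<in> sklyanin_quadrics v"
      by (simp add: sklyanin_quadrics_def algebra_simps)
  next
    fix M x assume "M \<in> sklyanin_quadrics v"
    hence "M a a = 0" "distinct [a, b, c, d] \<Longrightarrow> x * (M c d + M d c) =
         x * (twist v a b * (M a b - M b a))" for a b c d
      by (auto simp: sklyanin_quadrics_def)
    thus "(\<lambda>i j. x * M i j) \<in> sklyanin_quadrics v"
      by (simp add: sklyanin_quadrics_def algebra_simps)
  qed
  note quadratic = relation_ideal_quadratic[of "sklyanin_relations v" "sklyanin_quadrics v" f]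
  show "word_coeff f [i] = 0"
    by (rule quadratic(1)) (fact hom sklyanin_relations_quadrics W assms)+
  show "(\<lambda>x y. word_coeff f [x, y]) \<in> sklyanin_quadrics v"
    by (rule quadratic(2)) (fact hom sklyanin_relations_quadrics W assms)+
qed

section \<open>From an isomorphism to a permutation of the generators\<close>

text \<open>
  A matrix with independent rows has nonzero determinant, so some term of the Leibniz formula
  is nonzero.
\<close>

lemma exists_nonzero_transversal:
  fixes P :: "'n::finite \<Rightarrow> 'n \<Rightarrow> 'a::field"
  assumes indep: "\<forall>c. (\<forall>y. (\<Sum>x\<in>UNIV. c x * P x y) = 0) \<longrightarrow> (\<forall>x. c x = 0)"
  shows "\<exists>\<pi>. inj \<pi> \<and> (\<forall>x. P x (\<pi> x) \<noteq> 0)"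
proof -
  define A :: "'a ^ 'n ^ 'n" where "A = (\<chi> x y. P x y)"
  have "\<forall>c. (\<Sum>i\<in>UNIV. c i *s row i A) = 0 \<longrightarrow> (\<forall>i. c i = 0)"
  proof (intro allI impI)
    fix c i assume "(\<Sum>i\<in>UNIV. c i *s row i A) = 0"
    hence "(\<Sum>x\<in>UNIV. c x * P x y) = 0" for y
      by (simp add: vec_eq_iff row_def A_def)
    thus "c i = 0" using indep by blast
  qed
  hence "\<exists>B. A ** B = mat 1"
    by (simp add: matrix_right_invertible_independent_rows)
  hence "invertible A"
    by (simp add: invertible_right_inverse)
  hence "det A \<noteq> 0"
    by (simp add: invertible_det_nz)
  then obtain \<pi> where "\<pi> permutes UNIV" "(\<Prod>i\<in>UNIV. A $ i $ \<pi> i) \<noteq> 0"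
    unfolding det_def by (metis (no_types, lifting) mem_Collect_eq mult_zero_right sum.neutral)
  thus ?thesis
    by (intro exI[of _ \<pi>]) (auto simp: A_def permutes_inj)
qed

text \<open>
  The central computation. Relations of \<open>w\<close> have no squares, so column \<open>m\<close> of \<open>P\<close> satisfies
  \<open>P 0 m * P i m = 0\<close>, and also \<open>P j m * P k m = 0\<close> unless \<open>twist v 0 i = 0\<close>. Comparing
  coefficients at the positions chosen by \<open>\<pi>\<close> in the images of the two relations that belong to
  the splitting \<open>{0,i}, {j,k}\<close> gives two equations whose product is the claim.
  If \<open>twist v 0 i = 0\<close>, then the first of them already shows that both sides vanish; this
  case has to be separated because rows \<open>j\<close> and \<open>k\<close> of \<open>P\<close> may then mix.
\<close>

lemma twist_products_match:
  fixes P :: "4 \<Rightarrow> 4 \<Rightarrow> complex"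
  assumes quadric: "\<And>a b c d. distinct [a, b, c, d] \<Longrightarrow>
      (\<lambda>x y. P a x * P b y - P b x * P a y + twist v a b * (P c x * P d y + P d x * P c y))
        \<in> sklyanin_quadrics w"
    and \<pi>: "inj \<pi>" "\<And>a. P a (\<pi> a) \<noteq> 0"
    and ijk: "distinct [0, i, j, k]"
  shows "twist v 0 i * twist v j k = twist w (\<pi> 0) (\<pi> i) * twist w (\<pi> j) (\<pi> k)"
proof -
  have diag: "twist v a b * (P c m * P d m) = 0" if "distinct [a, b, c, d]" for a b c d m
    using quadric[OF that] by (auto simp: sklyanin_quadrics_def mult.commute)
  have coeff: "twist v a b * (P c (\<pi> c) * P d (\<pi> d) + P d (\<pi> c) * P c (\<pi> d)) =
      twist w (\<pi> a) (\<pi> b) * (P a (\<pi> a) * P b (\<pi> b) - P b (\<pi> a) * P a (\<pi> b))"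
    if "distinct [a, b, c, d]" for a b c d
  proof -
    have "distinct [\<pi> a, \<pi> b, \<pi> c, \<pi> d]"
      using that \<pi>(1) by (auto simp: inj_eq)
    with quadric[OF that] have
      "2 * (twist v a b * (P c (\<pi> c) * P d (\<pi> d) + P d (\<pi> c) * P c (\<pi> d))) =
       2 * (twist w (\<pi> a) (\<pi> b) * (P a (\<pi> a) * P b (\<pi> b) - P b (\<pi> a) * P a (\<pi> b)))"
      unfolding sklyanin_quadrics_def mem_Collect_eq
      by (elim conjE allE[of _ "\<pi> a"] allE[of _ "\<pi> b"] allE[of _ "\<pi> c"] allE[of _ "\<pi> d"])
         (simp add: algebra_simps)
    thus ?thesis by simp
  qed
  have perms: "distinct [j, k, 0, i]" using ijk by auto
  have "twist v j k \<noteq> 0"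
    using ijk by (auto simp: twist_def)
  hence P0i: "P 0 m * P i m = 0" for m
    using diag[OF perms, of m] by simp
  \<comment> \<open>The entries at \<open>(0, \<pi> 0)\<close> and \<open>(i, \<pi> i)\<close> are nonzero, so the other factor vanishes.\<close>
  have zero: "P 0 (\<pi> i) = 0" "P i (\<pi> 0) = 0"
    using P0i[of "\<pi> i"] P0i[of "\<pi> 0"] \<pi>(2) by auto
  have E1: "twist v 0 i * (P j (\<pi> j) * P k (\<pi> k) + P k (\<pi> j) * P j (\<pi> k)) =
      twist w (\<pi> 0) (\<pi> i) * (P 0 (\<pi> 0) * P i (\<pi> i))"
    using coeff[OF ijk] zero by simp
  have E2: "twist v j k * (P 0 (\<pi> 0) * P i (\<pi> i)) =
      twist w (\<pi> j) (\<pi> k) * (P j (\<pi> j) * P k (\<pi> k) - P k (\<pi> j) * P j (\<pi> k))"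
    using coeff[OF perms] zero by simp
  show ?thesis
  proof (cases "twist v 0 i = 0")
    case True
    thus ?thesis using E1 \<pi>(2) by simp
  next
    case False
    have "P j (\<pi> k) = 0"
      using diag[OF ijk, of "\<pi> k"] False \<pi>(2)[of k] by simp
    with E1 E2 have
      "twist v 0 i * (P j (\<pi> j) * P k (\<pi> k)) = twist w (\<pi> 0) (\<pi> i) * (P 0 (\<pi> 0) * P i (\<pi> i))"
      "twist v j k * (P 0 (\<pi> 0) * P i (\<pi> i)) = twist w (\<pi> j) (\<pi> k) * (P j (\<pi> j) * P k (\<pi> k))"
      by simp_all
    hence "(twist v 0 i * (P j (\<pi> j) * P k (\<pi> k))) * (twist v j k * (P 0 (\<pi> 0) * P i (\<pi> i))) =
        (twist w (\<pi> 0) (\<pi> i) * (P 0 (\<pi> 0) * P i (\<pi> i))) *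
        (twist w (\<pi> j) (\<pi> k) * (P j (\<pi> j) * P k (\<pi> k)))"
      by (rule arg_cong2)
    hence "(twist v 0 i * twist v j k) * (P 0 (\<pi> 0) * P i (\<pi> i) * P j (\<pi> j) * P k (\<pi> k)) =
        (twist w (\<pi> 0) (\<pi> i) * twist w (\<pi> j) (\<pi> k)) *
        (P 0 (\<pi> 0) * P i (\<pi> i) * P j (\<pi> j) * P k (\<pi> k))"
      by (simp only: mult_ac)
    thus ?thesis using \<pi>(2) by simp
  qed
qed

lemma sklyanin_iso_imp_twist_products:
  assumes "graded_isomorphic (sklyanin v) (sklyanin w)"
  shows "\<exists>\<pi>. inj \<pi> \<and> (\<forall>i j k. distinct [0, i, j, k] \<longrightarrow>
    twist v 0 i * twist v j k = twist w (\<pi> 0) (\<pi> i) * twist w (\<pi> j) (\<pi> k))"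
proof -
  from assms obtain h where
    "h \<in> graded_iso (presented_algebra (sklyanin_relations v)) (presented_algebra (sklyanin_relations w))"
    unfolding graded_isomorphic_def sklyanin_def by blast
  from graded_iso_is_substitution[OF this] obtain l where l: "\<And>a. l a \<in> homogeneous 1"
    and ideal: "\<And>f. f \<in> relation_ideal (sklyanin_relations v) \<longleftrightarrow>
      subst l f \<in> relation_ideal (sklyanin_relations w)"
    by blast
  define P where "P a x = word_coeff (l a) [x]" for a x
  \<comment> \<open>A dependence between the images of the generators would put a nonzero linear form into the ideal.\<close>
  have "c a = 0" if c: "\<And>x. (\<Sum>a\<in>UNIV. c a * P a x) = 0" for c a
  proof -
    define f where "f = (\<Sum>a\<in>UNIV. scalar (c a) * gen a)"
    have "subst l f = (\<Sum>a\<in>UNIV. scalar (c a) * l a)"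
      by (simp add: f_def subst_sum subst_simps)
    moreover have "(\<Sum>a\<in>UNIV. scalar (c a) * l a) \<in> homogeneous 1"
      by (intro homogeneous_sum homogeneous_scalar_mult l)
    moreover have "word_coeff (\<Sum>a\<in>UNIV. scalar (c a) * l a) [x] = 0" for x
      using c[of x] by (simp add: lookup_sum lookup_scalar_mult P_def)
    ultimately have "subst l f = 0"
      using linear_form_expansion[of "subst l f"] by simp
    hence "f \<in> relation_ideal (sklyanin_relations v)"
      by (simp add: ideal relation_ideal_zero)
    hence "word_coeff f [a] = 0" by (rule relation_ideal_sklyanin)
    thus "c a = 0"
      by (simp add: f_def lookup_sum lookup_scalar_mult lookup_gen if_distrib[of "(*) _"] cong: if_cong)
  qed
  hence "\<forall>c. (\<forall>x. (\<Sum>a\<in>UNIV. c a * P a x) = 0) \<longrightarrow> (\<forall>a. c a = 0)"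
    by blast
  from exists_nonzero_transversal[OF this]
  obtain \<pi> where \<pi>: "inj \<pi>" "\<And>a. P a (\<pi> a) \<noteq> 0"
    by blast
  have "(\<lambda>x y. P a x * P b y - P b x * P a y + twist v a b * (P c x * P d y + P d x * P c y))
      \<in> sklyanin_quadrics w" if "distinct [a, b, c, d]" for a b c d
  proof -
    have "subst l (twisted_commutator v a b c d) \<in> relation_ideal (sklyanin_relations w)"
      using twisted_commutator_in_ideal[OF that] ideal by blast
    from relation_ideal_sklyanin(2)[OF this] show ?thesis
      by (simp only: coeff_twisted_commutator[OF l P_def[symmetric]])
  qed
  from twist_products_match[OF this \<pi>] \<pi>(1) show ?thesis
    by blast
qed

section \<open>Orbits of parameters\<close>

interpretation param: group_action S3 sklyanin_params signed_perm
  by (rule group_action_signed_perm)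

lemma bij_in_orbit: "bij \<sigma> \<Longrightarrow> signed_perm \<sigma> v \<in> param_orbit v"
  by (auto simp: param_orbit_def orbit_def BijGroup_def Bij_def)

lemma param_orbit_subset: "v \<in> sklyanin_params \<Longrightarrow> u \<in> param_orbit v \<Longrightarrow> u \<in> sklyanin_params"
  by (auto simp: param_orbit_def orbit_def BijGroup_def Bij_def signed_perm_closed)

lemma param_orbit_trans:
  "w \<in> sklyanin_params \<Longrightarrow> v \<in> param_orbit w \<Longrightarrow> u \<in> param_orbit v \<Longrightarrow> u \<in> param_orbit w"
  using param.orbit_trans[of w v u] param_orbit_subset unfolding param_orbit_def by blast

lemma param_orbit_eq:
  assumes w: "w \<in> sklyanin_params" and v: "v \<in> param_orbit w"
  shows "param_orbit v = param_orbit w"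
proof -
  have v': "v \<in> sklyanin_params" by (rule param_orbit_subset[OF w v])
  have "w \<in> param_orbit v"
    using param.orbit_sym[OF w v'] v by (simp only: param_orbit_def)
  thus ?thesis
    using param_orbit_trans[OF w v] param_orbit_trans[OF v'] by (intro equalityI subsetI)
qed

lemma orbit_rotation:
  assumes "w \<in> sklyanin_params"
  shows "vector [w $ 3, w $ 1, w $ 2] \<in> param_orbit w"
proof -
  let ?\<sigma> = "Transposition.transpose 1 2 \<circ> Transposition.transpose 2 (3::3)"
  have "bij ?\<sigma>" by (intro bij_comp bij_transpose)
  moreover have "signed_perm ?\<sigma> w = vector [w $ 3, w $ 1, w $ 2]"
    by (rule signed_perm_cyclic) (use assms in \<open>simp_all add: Transposition.transpose_def\<close>)
  ultimately show ?thesis using bij_in_orbit by metis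
qed

lemma orbit_reflection:
  assumes "w \<in> sklyanin_params"
  shows "vector [- (w $ 2), - (w $ 1), - (w $ 3)] \<in> param_orbit w"
  using bij_in_orbit[of "Transposition.transpose 1 2" w] signed_perm_transposition[OF assms]
  by simp

text \<open>
  The six elements are generated by the rotation and the reflection of the preceding lemmas.
\<close>

lemma param_orbit_listI:
  assumes w: "w \<in> sklyanin_params"
    and v: "(v $ 1, v $ 2, v $ 3) \<in>
      {(w $ 1, w $ 2, w $ 3), (w $ 3, w $ 1, w $ 2), (w $ 2, w $ 3, w $ 1),
       (- (w $ 2), - (w $ 1), - (w $ 3)), (- (w $ 1), - (w $ 3), - (w $ 2)),
       (- (w $ 3), - (w $ 2), - (w $ 1))}"
  shows "v \<in> param_orbit w"
proof -
  define r :: "complex ^ 3 \<Rightarrow> complex ^ 3" where "r = (\<lambda>u. vector [u $ 3, u $ 1, u $ 2])"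
  define t :: "complex ^ 3 \<Rightarrow> complex ^ 3" where "t = (\<lambda>u. vector [- (u $ 2), - (u $ 1), - (u $ 3)])"
  have rt: "r u \<in> param_orbit w" "t u \<in> param_orbit w" if "u \<in> param_orbit w" for u
    using that param_orbit_trans[OF w that] param_orbit_subset[OF w that] orbit_rotation[of u]
      orbit_reflection[of u] by (auto simp: r_def t_def)
  have "w \<in> param_orbit w"
    using param.orbit_refl[OF w] by (simp add: param_orbit_def)
  hence "{w, r w, r (r w), t w, t (r w), t (r (r w))} \<subseteq> param_orbit w"
    by (simp add: rt)
  moreover have "v \<in> {w, r w, r (r w), t w, t (r w), t (r (r w))}"
    using v by (auto simp: vec_eq_iff forall_3 r_def t_def)
  ultimately show ?thesis by blast
qed

text \<open>
  For each of the 24 permutations the three products of twists are, up to a common sign, a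
  rearrangement of the coordinates of \<open>w\<close>; the sign is that of the rearrangement.
\<close>

lemma sklyanin_iso_imp_orbit:
  assumes w: "w \<in> sklyanin_params" and iso: "graded_isomorphic (sklyanin v) (sklyanin w)"
  shows "v \<in> param_orbit w"
proof -
  obtain \<pi> where \<pi>: "inj \<pi>" "\<And>i j k. distinct [0, i, j, k] \<Longrightarrow>
    twist v 0 i * twist v j k = twist w (\<pi> 0) (\<pi> i) * twist w (\<pi> j) (\<pi> k)"
    using sklyanin_iso_imp_twist_products[OF iso] by blast
  let ?K = "\<lambda>a b c d. twist w a b * twist w c d"
  have v: "v $ 1 = ?K (\<pi> 0) (\<pi> 1) (\<pi> 2) (\<pi> 3)" "v $ 2 = ?K (\<pi> 0) (\<pi> 2) (\<pi> 3) (\<pi> 1)"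
    "v $ 3 = ?K (\<pi> 0) (\<pi> 3) (\<pi> 1) (\<pi> 2)"
    using \<pi>(2)[of 1 2 3] \<pi>(2)[of 2 3 1] \<pi>(2)[of 3 1 2] by (simp_all add: twist_values)
  have "\<forall>a b c d. distinct [a, b, c, d] \<longrightarrow>
      (?K a b c d, ?K a c d b, ?K a d b c) \<in>
      {(w $ 1, w $ 2, w $ 3), (w $ 3, w $ 1, w $ 2), (w $ 2, w $ 3, w $ 1),
       (- (w $ 2), - (w $ 1), - (w $ 3)), (- (w $ 1), - (w $ 3), - (w $ 2)),
       (- (w $ 3), - (w $ 2), - (w $ 1))}"
    by (simp add: all_4 twist_values)
  moreover have "distinct [\<pi> 0, \<pi> 1, \<pi> 2, \<pi> 3]"
    using \<pi>(1) by (simp add: inj_eq)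
  ultimately show ?thesis
    unfolding v[symmetric] by (intro param_orbit_listI[OF w]) (simp only: v)
qed

section \<open>From a transposition of the parameters to an isomorphism\<close>

lemma graded_isomorphic_trans:
  assumes "graded_isomorphic A B" "graded_isomorphic B C"
  shows "graded_isomorphic A C"
proof -
  from assms obtain g h where gh: "g \<in> graded_iso A B" "h \<in> graded_iso B C"
    unfolding graded_isomorphic_def by blast
  hence "h \<circ> g \<in> ring_iso A C"
    using ring_iso_set_trans by (auto simp: graded_iso_def)
  moreover have "(h \<circ> g) (c \<odot>\<^bsub>A\<^esub> x) = c \<odot>\<^bsub>C\<^esub> (h \<circ> g) x" if "x \<in> carrier A" for c x
  proof -
    have "g x \<in> carrier B"
      using gh that by (auto simp: graded_iso_def ring_iso_def bij_betw_def)
    thus ?thesis using gh that by (simp add: graded_iso_def)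
  qed
  moreover have "(h \<circ> g) ` part A n = part C n" for n
    unfolding image_comp[symmetric] using gh by (simp add: graded_iso_def)
  ultimately have "h \<circ> g \<in> graded_iso A C"
    by (simp add: graded_iso_def)
  thus ?thesis unfolding graded_isomorphic_def by blast
qed

text \<open>
  The involution \<open>x\<^sub>0 \<mapsto> - x\<^sub>0\<close>, \<open>x\<^sub>a \<mapsto> x\<^bsub>\<tau> a\<^esub>\<close> maps the relation of a splitting to the relation of
  the permuted splitting, up to sign. Exactly one of the two pairs contains 0, so the change of
  sign of \<open>x\<^sub>0\<close> changes the sign of one term relative to the other; the twist has to absorb it.
\<close>

lemma sklyanin_iso_by_involution:
  assumes \<tau>: "\<And>a. \<tau> (\<tau> a) = a" "\<tau> 0 = 0"
    and tw: "\<And>a b. a \<noteq> b \<Longrightarrow> twist w (\<tau> a) (\<tau> b) = - twist v a b"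
  shows "graded_isomorphic (sklyanin v) (sklyanin w)"
proof -
  define y where "y a = (if a = 0 then - gen 0 else gen (\<tau> a))" for a :: 4
  have \<tau>0: "\<tau> a = 0 \<longleftrightarrow> a = 0" for a using \<tau> by metis
  have hom: "y a \<in> homogeneous 1" for a
    by (simp del: One_nat_def add: y_def gen_homogeneous homogeneous_uminus)
  have inv: "subst y (y a) = gen a" for a
    by (simp add: y_def subst_simps \<tau>0 \<tau>)
  have ideal: "subst y r \<in> relation_ideal (sklyanin_relations w')"
    if r: "r \<in> sklyanin_relations v'"
      and tw': "\<And>a b. a \<noteq> b \<Longrightarrow> twist w' (\<tau> a) (\<tau> b) = - twist v' a b" for r v' w'
  proof -
    have *: "subst y (twisted_commutator v' a b c d) \<in> relation_ideal (sklyanin_relations w')"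
      if dist: "distinct [a, b, c, d]" and zero: "0 \<in> {a, b, c, d}" for a b c d
    proof -
      let ?s = "twisted_commutator w' (\<tau> a) (\<tau> b) (\<tau> c) (\<tau> d)"
      have "distinct [\<tau> a, \<tau> b, \<tau> c, \<tau> d]"
        using dist \<tau>(1) by (metis (no_types, lifting) distinct_map inj_on_def list.simps(8,9))
      hence s: "?s \<in> relation_ideal (sklyanin_relations w')"
        by (rule twisted_commutator_in_ideal)
      have "twist w' (\<tau> a) (\<tau> b) = - twist v' a b"
        by (rule tw') (use dist in simp)
      hence "subst y (twisted_commutator v' a b c d) \<in> {?s, - ?s}"
        using dist zero
        by (auto simp: twisted_commutator_def subst_simps y_def \<tau>(2) scalar_uminus algebra_simps)
      thus ?thesis using s relation_ideal_uminus by auto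
    qed
    show ?thesis
      using r[unfolded sklyanin_relations_eq]
      by (elim insertE emptyE) (simp_all add: subst_uminus relation_ideal_uminus *)
  qed
  have tw_inv: "twist v (\<tau> a) (\<tau> b) = - twist w a b" if "a \<noteq> b" for a b
    using tw[of "\<tau> a" "\<tau> b"] that \<tau>(1) by (metis minus_minus)
  show ?thesis
    unfolding sklyanin_def
    by (rule graded_isomorphic_by_substitution[of y _ _ y])
       (use hom inv ideal tw tw_inv in auto)
qed

text \<open>
  An odd permutation of 1, 2, 3 reverses the cyclic order, hence changes the sign of the
  constant twists; the sign in the action does the same to the twists \<open>twist v 0 a\<close>.
\<close>

lemma sklyanin_iso_transposition:
  assumes v: "v \<in> sklyanin_params" and ij: "i \<noteq> j"
  shows "graded_isomorphic (sklyanin v) (sklyanin (signed_perm (Transposition.transpose i j) v))"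
proof -
  let ?t = "Transposition.transpose i j"
  define w where "w = signed_perm ?t v"
  have "inv_into UNIV ?t = ?t"
    by (rule inv_equality) simp_all
  hence w: "w $ m = - v $ ?t m" for m
    using v ij by (simp add: w_def signed_perm_def sign_swap_id)
  \<comment> \<open>Lift the transposition from the parameter indices to the generators.\<close>
  have "{i, j} = {1, 2} \<or> {i, j} = {1, 3} \<or> {i, j} = {2, 3}"
    using ij exhaust_3[of i] exhaust_3[of j] by auto
  then obtain k l where kl: "(k, l) \<in> {(1, 2), (1, 3), (2, 3 :: 4)}" "{i, j} = {index k, index l}"
    by (elim disjE) (force simp: index_def)+
  hence ijkl: "?t = Transposition.transpose (index k) (index l)"
    by (auto simp: doubleton_eq_iff Transposition.transpose_commute)
  have w_coords: "w $ 1 = - v $ Transposition.transpose (index k) (index l) 1"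
    "w $ 2 = - v $ Transposition.transpose (index k) (index l) 2"
    "w $ 3 = - v $ Transposition.transpose (index k) (index l) 3"
    unfolding w ijkl by simp_all
  have "graded_isomorphic (sklyanin v) (sklyanin w)"
  proof (rule sklyanin_iso_by_involution[of "Transposition.transpose k l"])
    have "\<forall>a b. a \<noteq> b \<longrightarrow>
       twist w (Transposition.transpose k l a) (Transposition.transpose k l b) = - twist v a b"
      using kl(1) w_coords unfolding all_4
      by (auto simp: twist_values Transposition.transpose_def index_def)
    thus "twist w (Transposition.transpose k l a) (Transposition.transpose k l b) = - twist v a b"
      if "a \<noteq> b" for a b
      using that by blast
  qed (use kl in \<open>auto simp: Transposition.transpose_def\<close>)
  thus ?thesis by (simp only: w_def)
qed

lemma sklyanin_iso_signed_perm:
  assumes v: "v \<in> sklyanin_params" and "bij \<sigma>"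
  shows "graded_isomorphic (sklyanin v) (sklyanin (signed_perm \<sigma> v))"
proof -
  have "\<sigma> permutes UNIV" using assms(2) by (auto intro: bij_imp_permutes)
  from this finite show ?thesis
  proof (induction rule: permutes_induct)
    case id
    have "signed_perm id v = v" using v by (simp add: signed_perm_def vec_eq_iff)
    thus ?case by (simp only: graded_isomorphic_refl)
  next
    case (swap i j p)
    have b: "bij p" using swap by (simp add: permutes_bij)
    have "signed_perm (Transposition.transpose i j \<circ> p) v =
        signed_perm (Transposition.transpose i j) (signed_perm p v)"
      using param.composition_rule[OF v, of "Transposition.transpose i j" p] b
      by (simp add: BijGroup_def Bij_def compose_def comp_def restrict_UNIV)
    thus ?case
      using swap graded_isomorphic_trans sklyanin_iso_transposition signed_perm_closed[OF b v]
      by metis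
  qed
qed

section \<open>The classification\<close>

lemma sklyanin_iso_iff_orbit:
  assumes "v \<in> sklyanin_params" "w \<in> sklyanin_params"
  shows "graded_isomorphic (sklyanin v) (sklyanin w) \<longleftrightarrow> param_orbit v = param_orbit w"
proof
  assume "graded_isomorphic (sklyanin v) (sklyanin w)"
  thus "param_orbit v = param_orbit w"
    by (intro param_orbit_eq sklyanin_iso_imp_orbit assms)
next
  assume "param_orbit v = param_orbit w"
  hence "w \<in> param_orbit v"
    using param.orbit_refl[of w] assms by (simp add: param_orbit_def)
  then obtain \<sigma> where "bij \<sigma>" "w = signed_perm \<sigma> v"
    by (auto simp: param_orbit_def orbit_def BijGroup_def Bij_def)
  thus "graded_isomorphic (sklyanin v) (sklyanin w)"
    using sklyanin_iso_signed_perm assms by blast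
qed

lemma sklyanin_iso_class_eq:
  assumes "v \<in> sklyanin_params"
  shows "sklyanin_iso_class v = {sklyanin u | u. u \<in> sklyanin_params \<and> param_orbit u = param_orbit v}"
  using assms by (auto simp: sklyanin_iso_class_def sklyanin_iso_rel_def sklyanin_iso_iff_orbit)

lemma sklyanin_iso_class_eq_iff:
  assumes "v \<in> sklyanin_params" "w \<in> sklyanin_params"
  shows "sklyanin_iso_class v = sklyanin_iso_class w \<longleftrightarrow> param_orbit v = param_orbit w"
proof
  assume "sklyanin_iso_class v = sklyanin_iso_class w"
  hence "sklyanin v \<in> sklyanin_iso_class w"
    using sklyanin_in_class[OF assms(1)] by simp
  hence "graded_isomorphic (sklyanin w) (sklyanin v)"
    by (simp add: sklyanin_iso_class_def sklyanin_iso_rel_def)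
  thus "param_orbit v = param_orbit w"
    using sklyanin_iso_iff_orbit assms by simp
qed (simp add: sklyanin_iso_class_eq assms)

theorem theorem7p9:
  shows "(\<forall>v \<in> sklyanin_params. orbit_to_class (param_orbit v) = sklyanin_iso_class v) \<and>
         bij_betw orbit_to_class param_orbits sklyanin_iso_classes"
proof
  show val: "\<forall>v \<in> sklyanin_params. orbit_to_class (param_orbit v) = sklyanin_iso_class v"
  proof
    fix v assume v: "v \<in> sklyanin_params"
    have "sklyanin_iso_class u = sklyanin_iso_class v" if "u \<in> param_orbit v" for u
      using sklyanin_iso_class_eq_iff[OF param_orbit_subset[OF v that] v] param_orbit_eq[OF v that]
      by blast
    moreover have "v \<in> param_orbit v"
      using param.orbit_refl[OF v] by (simp add: param_orbit_def)
    ultimately have "sklyanin_iso_class ` param_orbit v = {sklyanin_iso_class v}"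
      by blast
    thus "orbit_to_class (param_orbit v) = sklyanin_iso_class v"
      by (simp add: orbit_to_class_def)
  qed
  have orbits: "param_orbits = param_orbit ` sklyanin_params"
    by (auto simp: param_orbits_def orbits_def param_orbit_def)
  have classes: "sklyanin_iso_classes = sklyanin_iso_class ` sklyanin_params"
    by (auto simp: sklyanin_iso_classes_def sklyanin_iso_class_def quotient_def)
  show "bij_betw orbit_to_class param_orbits sklyanin_iso_classes"
    unfolding bij_betw_def
  proof
    show "inj_on orbit_to_class param_orbits"
      unfolding orbits
      by (intro inj_onI) (elim imageE, simp add: val[rule_format] sklyanin_iso_class_eq_iff)
    show "orbit_to_class ` param_orbits = sklyanin_iso_classes"
      unfolding orbits classes image_image by (intro image_cong refl) (rule val[rule_format])
  qed
qed

end
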